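(* Let $S$ be a primitive non-powerful signed digraph of order $n\ge 6$ whose underlying digraph $D$ is isomorphic neither to $D_1$ nor to $D_2$. Then for every integer $k$ with $1\le k\le n$, $L(S,k) \le (2n-k)(n-1)-3$.
   Context: A signed digraph $S$ is a digraph (loops allowed, no multiple arcs) on a finite vertex set in which each arc is assigned a sign $1$ or $-1$; its underlying digraph is obtained by forgetting the signs, and its order is its number of vertices. A walk of length $m$ is a sequence of arcs $e_1,\dots,e_m$ such that the terminal vertex of $e_i$ is the initial vertex of $e_{i+1}$; for each vertex $u$ there is also the trivial walk of length $0$ from $u$ to $u$. The sign of a walk is the product of the signs of its arcs (the trivial walk has sign $1$). Two walks form a pair of SSSD walks if they have the same initial vertex, the same terminal vertex, the same length, but different signs. A digraph $D$ is primitive if there is a positive integer $m$ such that for every ordered pair $(u,v)$ of vertices there is a walk of length $m$ from $u$ to $v$; a signed digraph is primitive if its underlying digraph is. A signed digraph is non-powerful if it contains a pair of SSSD walks. For a primitive non-powerful signed digraph $S$ and $X \subseteq V(S)$, $l_S(X)$ is the least integer $p\ge 0$ such that for every vertex $v$ of $S$ there exist $x\in X$ and a pair of SSSD walks of length $p$ from $x$ to $v$; the $k$th upper base is $L(S,k)=\max\{l_S(X) : X\subseteq V(S),\ |X|=k\}$. $D_1$ is the digraph with vertex set $\{1,\dots,n\}$ and arcs $(i,i+1)$ for $1\le i\le n-1$, $(n,1)$ and $(n-1,1)$; $D_2$ is obtained from $D_1$ by adding the arc $(n,2)$. *)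

theory Defs
  imports "Graph_Theory.Graph_Theory"
begin

text \<open>
  Arcs are ordered pairs of vertices, so there are no multiple arcs, while loops are allowed.
  The values of \<open>arc_sign\<close> outside the arc set are irrelevant.
\<close>

record 'a signed_digraph =
  underlying :: "'a pair_pre_digraph"
  arc_sign :: "'a \<times> 'a \<Rightarrow> int"

locale signed_digraph =
  fixes S :: "'a signed_digraph"
  assumes underlying_fin_digraph: "pair_fin_digraph (underlying S)"
    and arc_sign_values: "\<And>e. e \<in> parcs (underlying S) \<Longrightarrow> arc_sign S e \<in> {1, -1}"

abbreviation sverts :: "'a signed_digraph \<Rightarrow> 'a set" where
  "sverts S \<equiv> pverts (underlying S)"

abbreviation swalk :: "'a signed_digraph \<Rightarrow> 'a \<Rightarrow> ('a \<times> 'a) awalk \<Rightarrow> 'a \<Rightarrow> bool" where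
  "swalk S \<equiv> pre_digraph.awalk (with_proj (underlying S))"

definition walk_sign :: "'a signed_digraph \<Rightarrow> ('a \<times> 'a) awalk \<Rightarrow> int" where
  "walk_sign S p = prod_list (map (arc_sign S) p)"

definition sssd_walks ::
    "'a signed_digraph \<Rightarrow> 'a \<Rightarrow> 'a \<Rightarrow> ('a \<times> 'a) awalk \<Rightarrow> ('a \<times> 'a) awalk \<Rightarrow> bool" where
  "sssd_walks S u v p q \<longleftrightarrow>
     swalk S u p v \<and> swalk S u q v \<and> length p = length q \<and> walk_sign S p \<noteq> walk_sign S q"

definition primitive_digraph :: "('a, 'b) pre_digraph \<Rightarrow> bool" where
  "primitive_digraph G \<longleftrightarrow>
     (\<exists>m>0. \<forall>u\<in>verts G. \<forall>v\<in>verts G. \<exists>p. pre_digraph.awalk G u p v \<and> length p = m)"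

definition primitive_signed :: "'a signed_digraph \<Rightarrow> bool" where
  "primitive_signed S \<longleftrightarrow> primitive_digraph (with_proj (underlying S))"

definition non_powerful :: "'a signed_digraph \<Rightarrow> bool" where
  "non_powerful S \<longleftrightarrow> (\<exists>u v p q. sssd_walks S u v p q)"

text \<open>
  The least exponent below exists when \<open>S\<close> is primitive and non-powerful and \<open>X\<close> is a
  nonempty set of vertices; the function is only meant to be used in that case.
\<close>

definition set_exponent :: "'a signed_digraph \<Rightarrow> 'a set \<Rightarrow> nat" where
  "set_exponent S X =
     (LEAST r. \<forall>v\<in>sverts S. \<exists>x\<in>X. \<exists>p q. sssd_walks S x v p q \<and> length p = r)"

definition upper_base :: "'a signed_digraph \<Rightarrow> nat \<Rightarrow> nat" where
  "upper_base S k = Max {set_exponent S X | X. X \<subseteq> sverts S \<and> card X = k}"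

definition D1 :: "nat \<Rightarrow> nat pair_pre_digraph" where
  "D1 n = \<lparr> pverts = {1..n},
            parcs = {(i, i + 1) | i. 1 \<le> i \<and> i \<le> n - 1} \<union> {(n, 1), (n - 1, 1)} \<rparr>"

definition D2 :: "nat \<Rightarrow> nat pair_pre_digraph" where
  "D2 n = \<lparr> pverts = pverts (D1 n), parcs = insert (n, 2) (parcs (D1 n)) \<rparr>"

end

theory Submission
  imports Defs
begin

text \<open>
  Let \<open>C\<close> be a shortest cycle, of length \<open>g\<close>. If \<open>g \<ge> n - 1\<close>, then primitivity forces the digraph
  to be a cycle of length \<open>n - 1\<close> with one further vertex inserted, that is, \<open>D\<^sub>1\<close> or \<open>D\<^sub>2\<close>.
  If \<open>g \<le> n - 2\<close>, fix \<open>c\<close> on \<open>C\<close> and consider the pairs (vertex \<open>u\<close>, sign \<open>s\<close>) for which a walk of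
  length \<open>g * j\<close> and sign \<open>s\<close> leads from \<open>u\<close> to \<open>c\<close>. Their number grows strictly with \<open>j\<close> up to
  \<open>2 * n\<close>, so for \<open>j = 2 * n - k\<close> at least \<open>n - k + 1\<close> vertices occur with both signs, and one of
  them lies in any given \<open>k\<close>-set. As every vertex is at the end of a walk of length \<open>n - g\<close> from \<open>C\<close>,
  the base is at most \<open>g * (2 * n - k) + (n - g)\<close>.
\<close>

section \<open>Primitive relations\<close>

text \<open>Walks are modelled by powers of the arc relation: \<open>(u, v) \<in> E ^^ l\<close>
  stands for a walk of length \<open>l\<close> from \<open>u\<close> to \<open>v\<close>. Signs are
  absent at this level.\<close>

locale primitive_relation =
  fixes V :: "'a set" and E :: "'a rel" and m :: nat
  assumes finite_verts: "finite V"
    and verts_nonempty: "V \<noteq> {}"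
    and arcs_subset: "E \<subseteq> V \<times> V"
    and m_pos: "0 < m"
    and relpow_m: "\<And>u v. u \<in> V \<Longrightarrow> v \<in> V \<Longrightarrow> (u, v) \<in> E ^^ m"
begin

lemma ex_out:
  assumes "u \<in> V"
  obtains v where "(u, v) \<in> E"
  using relpow_m[OF assms assms] m_pos by (metis Suc_pred' relpow_Suc_D2)

lemma ex_in:
  assumes "v \<in> V"
  obtains u where "(u, v) \<in> E"
  using relpow_m[OF assms assms] m_pos by (metis Suc_pred' relpow_Suc_E)

text \<open>Every vertex has a predecessor, and a walk reaching the predecessor extends by one
  arc.\<close>

lemma relpow_ge:
  assumes "m \<le> l" and "u \<in> V" and "v \<in> V"
  shows "(u, v) \<in> E ^^ l"
  using assms(1,3)
proof (induction l arbitrary: v rule: dec_induct)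
  case base
  then show ?case using relpow_m assms(2) by blast
next
  case (step l)
  obtain w where w: "(w, v) \<in> E" using ex_in step.prems by blast
  then have "w \<in> V" using arcs_subset by blast
  then show ?case using step.IH w by (meson relpow_Suc_I)
qed

text \<open>A grading modulo \<open>g\<close> makes the length of every closed walk divisible by
  \<open>g\<close>, but there are closed walks of the consecutive lengths \<open>m\<close> and
  \<open>Suc m\<close>.\<close>

lemma no_cyclic_grading:
  fixes h :: "'a \<Rightarrow> nat"
  assumes "2 \<le> g" and h: "\<And>x y. (x, y) \<in> E \<Longrightarrow> h y mod g = Suc (h x) mod g"
  shows False
proof -
  have grade: "h y mod g = (h x + l) mod g" if "(x, y) \<in> E ^^ l" for x y l
    using that
  proof (induction l arbitrary: y)
    case (Suc l)
    then obtain z where "(x, z) \<in> E ^^ l" "(z, y) \<in> E" by auto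
    then show ?case using Suc.IH[of z] h[of z y] by (metis add_Suc_right mod_Suc_eq)
  qed simp
  obtain x where "x \<in> V" using verts_nonempty by blast
  then have "(x, x) \<in> E ^^ m" "(x, x) \<in> E ^^ Suc m"
    using relpow_ge[of m] relpow_ge[of "Suc m"] by auto
  then have "h x mod g = (h x + m) mod g" "h x mod g = (h x + Suc m) mod g"
    using grade by blast+
  then have "(h x + m) mod g = Suc (h x + m) mod g" by simp
  then show False using \<open>2 \<le> g\<close> by (simp add: mod_Suc split: if_splits)
qed

text \<open>The iterated images of \<open>C\<close> form an increasing chain. If one step adds
  nothing, the chain is constant from there on, and primitivity makes it all of
  \<open>V\<close>.\<close>

lemma Image_grows:
  assumes "C \<subseteq> V" and "C \<noteq> {}" and "C \<subseteq> E `` C"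
  shows "min (card V) (card C + j) \<le> card ((E ^^ j) `` C)"
proof -
  let ?R = "\<lambda>j. (E ^^ j) `` C"
  have Suc_eq: "?R (Suc j) = E `` ?R j" for j by (simp add: relcomp_Image)
  have mono: "?R j \<subseteq> ?R (Suc j)" for j
  proof (induction j)
    case (Suc j)
    then show ?case by (metis Image_mono Suc_eq subset_refl)
  qed (use assms(3) in simp)
  have sub: "?R j \<subseteq> V" for j
  proof (cases j)
    case (Suc i)
    then show ?thesis using arcs_subset Suc_eq[of i] by auto
  qed (use assms(1) in simp)
  show ?thesis
  proof (induction j)
    case (Suc j)
    show ?case
    proof (cases "?R (Suc j) = ?R j")
      case True
      have const: "?R (i + j) = ?R j" for i
      proof (induction i)
        case (Suc i)
        then show ?case using True Suc_eq by (metis add_Suc)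
      qed simp
      obtain c where "c \<in> C" using assms(2) by blast
      then have "V \<subseteq> ?R (m + j)"
        using relpow_ge[of "m + j" c] assms(1) by auto
      then have "?R j = V" using const sub by blast
      then show ?thesis using True by simp
    next
      case False
      then have "card (?R j) < card (?R (Suc j))"
        by (intro psubset_card_mono finite_subset[OF sub finite_verts] psubsetI mono) simp
      then show ?thesis using Suc by simp
    qed
  qed simp
qed

end

section \<open>Shortest cycles, their chords and detours\<close>

locale shortest_cycle = primitive_relation +
  fixes g :: nat and c :: "nat \<Rightarrow> 'a"
  assumes g_pos: "0 < g"
    and girth: "\<And>x l. (x, x) \<in> E ^^ l \<Longrightarrow> 0 < l \<Longrightarrow> g \<le> l"
    and cycle_step: "\<And>i. (c i, c (Suc i)) \<in> E"
    and cycle_period: "\<And>i. c (i + g) = c i"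
begin

text \<open>Because the cycle is a periodic sequence over all indices, a change of base point is a
  mere shift.\<close>

lemma rotate: "shortest_cycle V E m g (\<lambda>i. c (i + r))"
proof -
  have "c (i + g + r) = c (i + r)" for i
    using cycle_period[of "i + r"] by (simp add: ac_simps)
  then show ?thesis
    using girth g_pos cycle_step by unfold_locales auto
qed

lemma cycle_in_verts: "c i \<in> V"
  using cycle_step[of i] arcs_subset by blast

lemma cycle_mod: "c (i mod g) = c i"
proof (induction i rule: less_induct)
  case (less i)
  show ?case
  proof (cases "i < g")
    case False
    then show ?thesis
      using less[of "i - g"] g_pos cycle_period[of "i - g"] by (simp add: le_mod_geq)
  qed simp
qed

lemma cycle_relpow: "i \<le> j \<Longrightarrow> (c i, c j) \<in> E ^^ (j - i)"
proof (induction j rule: dec_induct)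
  case (step j)
  then show ?case using cycle_step[of j] by (auto simp: Suc_diff_le)
qed simp

text \<open>The cycle from \<open>c i\<close> to \<open>c j\<close>, followed by the given walk
  back, is a closed walk, so \<open>girth\<close> applies. The restrictions on chords and detours
  below come from this.\<close>

lemma closed_via:
  assumes "i \<le> j" and "(c j, c i) \<in> E ^^ l" and "0 < l"
  shows "g \<le> (j - i) + l"
proof -
  have "(c i, c i) \<in> E ^^ ((j - i) + l)"
    using cycle_relpow[OF assms(1)] assms(2) by (auto simp: relpow_add)
  then show ?thesis using girth assms(3) by simp
qed

lemma inj_cycle: "inj_on c {..<g}"
proof (rule linorder_inj_onI')
  fix i j assume "i \<in> {..<g}" "j \<in> {..<g}" "i < j"
  then show "c i \<noteq> c j"
    using cycle_relpow[of i j] girth[of "c i" "j - i"] by auto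
qed

lemma card_cycle: "card (c ` {..<g}) = g"
  using inj_cycle by (simp add: card_image)

lemma girth_le_card: "g \<le> card V"
  using card_cycle cycle_in_verts finite_verts by (metis card_mono image_subsetI)

lemma chordless:
  assumes "(c i, c j) \<in> E" and "i < g" and "j < g"
  shows "j = Suc i mod g"
proof (cases "j \<le> i")
  case True
  then have "g \<le> Suc (i - j)" using closed_via[of j i 1] assms by simp
  then show ?thesis using True assms by (cases "Suc i = g") auto
next
  case False
  \<comment> \<open>Writing \<open>c i\<close> as \<open>c (i + g)\<close> lets the cycle run from
    \<open>c j\<close> past index \<open>g\<close> to \<open>c i\<close>.\<close>
  then have "g \<le> (i + g - j) + 1"
    using closed_via[of j "i + g" 1] assms cycle_period[of i] by simp
  then show ?thesis using False assms by auto
qed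

text \<open>A two-step passage that advanced by more than two positions would yield a closed walk
  shorter than \<open>g\<close>.\<close>

lemma detour:
  assumes "(c i, w) \<in> E" and "(w, c j) \<in> E" and "i < g" and "j < g"
  shows "j = (i + 1) mod g \<or> j = (i + 2) mod g"
proof -
  have two: "(c i, c j) \<in> E ^^ 2" using assms by (auto simp: numeral_2_eq_2)
  show ?thesis
  proof (cases "j \<le> i")
    case True
    then have "g \<le> (i - j) + 2" using closed_via[of j i 2] two by simp
    then have "i + 2 = g + j \<or> i + 1 = g + j" using True assms by linarith
    then show ?thesis using assms by (auto simp: mod_if)
  next
    case False
    then have "g \<le> (i + g - j) + 2"
      using closed_via[of j "i + g" 2] two cycle_period[of i] assms(4) by simp
    then have "j = i + 1 \<or> j = i + 2" using False assms by linarith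
    then show ?thesis using assms by auto
  qed
qed

text \<open>The \<open>g\<close> cycle vertices have predecessors on the cycle, so by
  \<open>Image_grows\<close> each step away from it gains a vertex until all of \<open>V\<close> is
  reached.\<close>

lemma walk_from_cycle:
  assumes "v \<in> V"
  obtains i where "(c i, v) \<in> E ^^ (card V - g)"
proof -
  let ?C = "c ` {..<g}" and ?j = "card V - g"
  have range_eq: "?C = range c"
  proof
    show "range c \<subseteq> ?C"
    proof
      fix x assume "x \<in> range c"
      then obtain i where "x = c (i mod g)" using cycle_mod by fastforce
      then show "x \<in> ?C" using g_pos by simp
    qed
  qed auto
  have "?C \<subseteq> V" using cycle_in_verts by auto
  moreover have "?C \<noteq> {}" using g_pos by auto
  moreover have "?C \<subseteq> E `` ?C"
  proof
    fix x assume "x \<in> ?C"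
    then obtain i where "x = c i" by blast
    \<comment> \<open>The index \<open>i + g - 1\<close> gives a predecessor also for
      \<open>i = 0\<close>.\<close>
    moreover have "c i = c (Suc (i + g - 1))" using cycle_period[of i] g_pos by simp
    ultimately have "(c (i + g - 1), x) \<in> E" using cycle_step by metis
    then show "x \<in> E `` ?C" unfolding range_eq by blast
  qed
  ultimately have "card V \<le> card ((E ^^ ?j) `` ?C)"
    using Image_grows[of ?C ?j] card_cycle girth_le_card by simp
  moreover have "(E ^^ ?j) `` ?C \<subseteq> V"
  proof (cases ?j)
    case (Suc i)
    then show ?thesis using arcs_subset by (auto simp: Suc)
  qed (use cycle_in_verts in auto)
  ultimately have "(E ^^ ?j) `` ?C = V"
    using finite_verts by (simp add: card_seteq)
  then show thesis using assms that by blast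
qed

text \<open>A shortest cycle through all vertices has no chords, so the position on it is a grading
  modulo \<open>g\<close>, which primitivity forbids.\<close>

lemma girth_less_card:
  assumes "2 \<le> card V"
  shows "g < card V"
proof (rule ccontr)
  assume "\<not> g < card V"
  then have g: "g = card V" using girth_le_card by simp
  have V: "V = c ` {..<g}"
    using card_cycle cycle_in_verts finite_verts g by (metis card_subset_eq image_subsetI)
  define h where "h = inv_into {..<g} c"
  have h: "h (c i) = i" if "i < g" for i
    unfolding h_def using inj_cycle that by simp
  have "h y mod g = Suc (h x) mod g" if xy: "(x, y) \<in> E" for x y
  proof -
    obtain i j where "x = c i" "y = c j" "i < g" "j < g" using xy arcs_subset V by blast
    then show ?thesis using chordless xy h by simp
  qed
  then show False using no_cyclic_grading assms g by blast
qed

text \<open>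
  If every detour through the vertex off the cycle replaced exactly one vertex of the cycle,
  that vertex would be a twin of a cycle vertex and the relation would be cyclically graded.
\<close>

lemma ex_insertion:
  assumes card_V: "card V = Suc g" and "3 \<le> g"
  obtains w a where "V = insert w (c ` {..<g})" "w \<notin> c ` {..<g}"
    "(c a, w) \<in> E" "(w, c (Suc a)) \<in> E"
proof -
  have "card (V - c ` {..<g}) = 1"
    using card_cycle card_V cycle_in_verts by (subst card_Diff_subset) auto
  then obtain w where w: "V - c ` {..<g} = {w}" by (auto simp: card_1_singleton_iff)
  have V: "V = insert w (c ` {..<g})" using w cycle_in_verts by blast
  have w_off: "w \<notin> c ` {..<g}" using w by blast
  have no_loop: "(w, w) \<notin> E" using girth[of w 1] \<open>3 \<le> g\<close> by auto
  obtain a where a: "a < g" "(c a, w) \<in> E"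
    using ex_in[of w] V no_loop arcs_subset by blast
  obtain b where b: "b < g" "(w, c b) \<in> E"
    using ex_out[of w] V no_loop arcs_subset by blast
  have "\<exists>i j. i < g \<and> j < g \<and> (c i, w) \<in> E \<and> (w, c j) \<in> E \<and> j = (i + 1) mod g"
  proof (rule ccontr)
    assume neg: "\<not> ?thesis"
    have det: "j = (i + 2) mod g" if "i < g" "j < g" "(c i, w) \<in> E" "(w, c j) \<in> E" for i j
      using detour[OF that(3,4,1,2)] neg that by blast
    \<comment> \<open>Every in-neighbour of \<open>w\<close> on the cycle lies two positions before
      the same \<open>c b\<close>, so there is only one.\<close>
    have in_w: "i = a" if "i < g" "(c i, w) \<in> E" for i
    proof -
      have "(i + 2) mod g = (a + 2) mod g" using det[OF that(1) b(1) that(2) b(2)] det[OF a(1) b(1) a(2) b(2)] by simp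
      then show ?thesis using that(1) a(1) \<open>3 \<le> g\<close> by (auto simp: mod_if split: if_splits)
    qed
    \<comment> \<open>The vertex \<open>w\<close> receives the position of its twin
      \<open>c (Suc a)\<close>.\<close>
    define h where "h x = (if x = w then Suc a else inv_into {..<g} c x)" for x
    have h: "h (c i) = i" if "i < g" for i
      using inj_cycle that w_off unfolding h_def by auto
    have hw: "h w = Suc a" by (simp add: h_def)
    have "h y mod g = Suc (h x) mod g" if xy: "(x, y) \<in> E" for x y
    proof -
      have "x \<in> V" "y \<in> V" using xy arcs_subset by auto
      then consider i j where "x = c i" "y = c j" "i < g" "j < g"
        | i where "x = c i" "y = w" "i < g" | j where "x = w" "y = c j" "j < g"
        using V no_loop xy by blast
      then show ?thesis
      proof cases
        case 1
        then show ?thesis using chordless xy h by simp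
      next
        case 2
        then show ?thesis using in_w xy h hw by simp
      next
        case 3
        then have "j = (a + 2) mod g" using det a xy by blast
        then show ?thesis using 3 h hw by simp
      qed
    qed
    moreover have "2 \<le> g" using \<open>3 \<le> g\<close> by simp
    ultimately show False using no_cyclic_grading by blast
  qed
  then obtain i where "(c i, w) \<in> E" "(w, c ((i + 1) mod g)) \<in> E" by blast
  then show thesis using that V w_off cycle_mod[of "i + 1"] by simp
qed

text \<open>With \<open>w\<close> inserted between \<open>c (g - 1)\<close> and \<open>c 0\<close>,
  the girth leaves one candidate for a further arc into \<open>w\<close> and one for a further arc
  out of \<open>w\<close>. Both together would give a closed walk of length
  \<open>g - 1\<close>.\<close>

lemma arcs_cases:
  assumes V: "V = insert w (c ` {..<g})" and w_off: "w \<notin> c ` {..<g}" and g: "4 \<le> g"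
    and in_w: "(c (g - 1), w) \<in> E" and out_w: "(w, c 0) \<in> E"
  defines "F \<equiv> (\<lambda>i. (c i, c (Suc i))) ` {..<g - 1} \<union> {(c (g - 1), c 0), (c (g - 1), w), (w, c 0)}"
  shows "E = F \<or> E = insert (w, c 1) F \<or> E = insert (c (g - 2), w) F"
proof -
  have no_loop: "(w, w) \<notin> E" using girth[of w 1] g by auto
  have in_w': "i = g - 1 \<or> i = g - 2" if "i < g" "(c i, w) \<in> E" for i
  proof -
    have "(c i, c 0) \<in> E ^^ 2" using that out_w by (auto simp: numeral_2_eq_2)
    then show ?thesis using closed_via[of 0 i 2] that by auto
  qed
  have out_w': "j = 0 \<or> j = 1" if "j < g" "(w, c j) \<in> E" for j
  proof -
    have "(c (g - 1), c j) \<in> E ^^ 2" using that in_w by (auto simp: numeral_2_eq_2)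
    moreover have "j \<le> g - 1" using that by simp
    ultimately have "g \<le> (g - 1 - j) + 2" using closed_via[of j "g - 1" 2] by simp
    then show ?thesis using that by linarith
  qed
  have not_both: "\<not> ((w, c 1) \<in> E \<and> (c (g - 2), w) \<in> E)"
  proof
    assume "(w, c 1) \<in> E \<and> (c (g - 2), w) \<in> E"
    then have "(c (g - 2), c 1) \<in> E ^^ 2" by (auto simp: numeral_2_eq_2)
    moreover have "1 \<le> g - 2" using g by simp
    ultimately have "g \<le> (g - 2 - 1) + 2" using closed_via[of 1 "g - 2" 2] by simp
    then show False using g by linarith
  qed
  have "c g = c 0" using cycle_period[of 0] by simp
  then have close: "(c (g - 1), c 0) \<in> E" using cycle_step[of "g - 1"] g_pos by simp
  have F_sub: "F \<subseteq> E" using cycle_step close in_w out_w by (auto simp: F_def)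
  have E_sub: "(x, y) \<in> F \<or> (x, y) = (w, c 1) \<or> (x, y) = (c (g - 2), w)" if xy: "(x, y) \<in> E" for x y
  proof -
    have "x \<in> V" "y \<in> V" using xy arcs_subset by auto
    then consider i j where "x = c i" "y = c j" "i < g" "j < g"
      | i where "x = c i" "y = w" "i < g" | j where "x = w" "y = c j" "j < g"
      using V no_loop xy by blast
    then show ?thesis
    proof cases
      case 1
      then have j: "j = Suc i mod g" using chordless xy by simp
      show ?thesis
      proof (cases "Suc i = g")
        case True
        then show ?thesis using 1 j by (auto simp: F_def)
      next
        case False
        then show ?thesis using 1 j by (auto simp: F_def)
      qed
    next
      case 2
      then show ?thesis using in_w'[of i] xy by (auto simp: F_def)
    next
      case 3
      then show ?thesis using out_w'[of j] xy by (auto simp: F_def)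
    qed
  qed
  have E_sub': "E \<subseteq> F \<union> {(w, c 1), (c (g - 2), w)}" using E_sub by auto
  show ?thesis
  proof (cases "(w, c 1) \<in> E")
    case True
    then have "E = insert (w, c 1) F" using F_sub E_sub' not_both by blast
    then show ?thesis by blast
  next
    case False
    then have "E \<subseteq> insert (c (g - 2), w) F" using E_sub' by blast
    then show ?thesis using F_sub by blast
  qed
qed

end

text \<open>A closed walk of least positive length, with indices read modulo \<open>g\<close>, is
  the required periodic sequence.\<close>

lemma (in primitive_relation) ex_shortest_cycle:
  obtains g c where "shortest_cycle V E m g c"
proof -
  define P where "P l \<longleftrightarrow> 0 < l \<and> (\<exists>x. (x, x) \<in> E ^^ l)" for l
  define g where "g = (LEAST l. P l)"
  have "P m" using verts_nonempty relpow_m m_pos by (auto simp: P_def)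
  then have Pg: "P g" unfolding g_def by (rule LeastI)
  then obtain x where "(x, x) \<in> E ^^ g" and g_pos: "0 < g" by (auto simp: P_def)
  then obtain f where f: "f 0 = x" "f g = x" "\<And>i. i < g \<Longrightarrow> (f i, f (Suc i)) \<in> E"
    by (auto simp: relpow_fun_conv)
  have "(f (i mod g), f (Suc i mod g)) \<in> E" for i
    using f(1,2) f(3)[of "i mod g"] g_pos by (auto simp: mod_Suc)
  moreover have "g \<le> l" if "(x, x) \<in> E ^^ l" "0 < l" for x l
    unfolding g_def by (rule Least_le) (use that in \<open>auto simp: P_def\<close>)
  ultimately have "shortest_cycle V E m g (\<lambda>i. f (i mod g))"
    using g_pos by unfold_locales auto
  then show thesis by (rule that)
qed

section \<open>Girth at least \<open>n - 1\<close>\<close>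

lemma wf_digraph_with_proj:
  assumes "pair_wf_digraph G"
  shows "wf_digraph (with_proj G)"
  using assms by (simp add: wf_digraph_def pair_wf_digraph_def)

text \<open>The map \<open>e\<close> goes from \<open>H\<close> to \<open>G\<close>, the convenient
  direction when \<open>H\<close> is a digraph on numbers; the isomorphism itself is its
  inverse.\<close>

lemma digraph_isoI_pair:
  assumes wf: "pair_wf_digraph G" and e: "bij_betw e (pverts H) (pverts G)"
    and arcs: "parcs G = map_prod e e ` parcs H" and H: "parcs H \<subseteq> pverts H \<times> pverts H"
  shows "digraph_iso (with_proj G) (with_proj H)"
proof -
  define f where "f = inv_into (pverts H) e"
  have f: "bij_betw f (pverts G) (pverts H)" unfolding f_def by (rule bij_betw_inv_into[OF e])
  have fe: "f (e x) = x" if "x \<in> pverts H" for x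
    unfolding f_def using e that by (simp add: bij_betw_def)
  define hom where "hom = \<lparr>iso_verts = f, iso_arcs = map_prod f f, iso_head = snd, iso_tail = fst\<rparr>"
  have "parcs G \<subseteq> pverts G \<times> pverts G" using wf by (auto simp: pair_wf_digraph_def)
  moreover have "inj_on (map_prod f f) (pverts G \<times> pverts G)"
    using f by (intro map_prod_inj_on) (auto simp: bij_betw_def)
  ultimately have "inj_on (map_prod f f) (parcs G)" by (rule inj_on_subset[rotated])
  then have "pre_digraph.digraph_isomorphism (with_proj G) hom"
    using f wf_digraph_with_proj[OF wf]
    unfolding pre_digraph.digraph_isomorphism_def hom_def by (auto simp: bij_betw_def)
  moreover have "with_proj H = app_iso hom (with_proj G)"
  proof -
    have "map_prod f f ` parcs G = parcs H"
    proof -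
      have "map_prod f f (map_prod e e a) = a" if "a \<in> parcs H" for a
        using that H fe by (cases a) auto
      then show ?thesis unfolding arcs image_image by simp
    qed
    then show ?thesis using f by (simp add: app_iso_def hom_def with_proj_def bij_betw_def)
  qed
  ultimately show ?thesis unfolding digraph_iso_def by blast
qed

lemma parcs_D1: "parcs (D1 (Suc g)) = (\<lambda>i. (i, Suc i)) ` {1..g} \<union> {(Suc g, 1), (g, 1)}"
  by (auto simp: D1_def)

lemma D1_arcs_subset: "2 \<le> n \<Longrightarrow> parcs (D1 n) \<subseteq> pverts (D1 n) \<times> pverts (D1 n)"
  by (auto simp: D1_def)

lemma D2_arcs_subset: "2 \<le> n \<Longrightarrow> parcs (D2 n) \<subseteq> pverts (D2 n) \<times> pverts (D2 n)"
  using D1_arcs_subset[of n] by (auto simp: D2_def D1_def)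

text \<open>Of the three arc sets in \<open>arcs_cases\<close>, the smallest is \<open>D1\<close>,
  and the other two are \<open>D2\<close> under different numberings.\<close>

lemma digraph_iso_D1_D2:
  assumes "pair_wf_digraph G" and "shortest_cycle (pverts G) (parcs G) m g c"
    and card_G: "card (pverts G) = Suc g" and g: "4 \<le> g"
  shows "digraph_iso (with_proj G) (with_proj (D1 (Suc g))) \<or>
    digraph_iso (with_proj G) (with_proj (D2 (Suc g)))"
proof -
  interpret base: shortest_cycle "pverts G" "parcs G" m g c by fact
  obtain w a where V0: "pverts G = insert w (c ` {..<g})" and w0: "w \<notin> c ` {..<g}"
    and a: "(c a, w) \<in> parcs G" "(w, c (Suc a)) \<in> parcs G"
    using base.ex_insertion card_G g by auto
  \<comment> \<open>The rotation places \<open>w\<close> between \<open>d (g - 1) = c a\<close> and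
    \<open>d 0 = c (Suc a)\<close>.\<close>
  define d where "d i = c (i + Suc a)" for i
  interpret shortest_cycle "pverts G" "parcs G" m g d
    using base.rotate[of "Suc a"] by (simp add: d_def[abs_def])
  have "d ` {..<g} \<subseteq> c ` {..<g}"
  proof
    fix x assume "x \<in> d ` {..<g}"
    then obtain i where "x = c (i + Suc a)" by (auto simp: d_def)
    then have "x = c ((i + Suc a) mod g)" by (simp only: base.cycle_mod)
    then show "x \<in> c ` {..<g}" using g_pos by simp
  qed
  then have same: "d ` {..<g} = c ` {..<g}"
    using card_cycle base.card_cycle by (metis card_subset_eq finite_imageI finite_lessThan)
  have V: "pverts G = insert w (d ` {..<g})" and w: "w \<notin> d ` {..<g}"
    using V0 w0 same by auto
  have in_w: "(d (g - 1), w) \<in> parcs G" and out_w: "(w, d 0) \<in> parcs G"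
    using a base.cycle_period[of a] g by (simp_all add: d_def ac_simps)
  define P where "P = (\<lambda>i. (d i, d (Suc i))) ` {..<g - 1}"
  define F where "F = P \<union> {(d (g - 1), d 0), (d (g - 1), w), (w, d 0)}"
  have cases: "parcs G = F \<or> parcs G = insert (w, d 1) F \<or> parcs G = insert (d (g - 2), w) F"
    using arcs_cases[OF V w g in_w out_w] unfolding F_def P_def by simp

  \<comment> \<open>In this numbering \<open>w\<close> is the last vertex \<open>Suc g\<close>, and
    the arc that \<open>D2\<close> adds to \<open>D1\<close> becomes
    \<open>(w, d 1)\<close>.\<close>
  define e where "e i = (if i = Suc g then w else d (i - 1))" for i
  have Suc_lessThan: "{1..g} = Suc ` {..<g}"
    by (auto simp: image_Suc_lessThan)
  have bij_e: "bij_betw e {1..Suc g} (pverts G)"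
  proof -
    have "e ` {1..Suc g} = pverts G"
    proof -
      have "{1..Suc g} = insert (Suc g) (Suc ` {..<g})" using Suc_lessThan by auto
      moreover have "e ` Suc ` {..<g} = d ` {..<g}"
        unfolding image_image by (rule image_cong) (auto simp: e_def)
      moreover have "e (Suc g) = w" by (simp add: e_def)
      ultimately show ?thesis unfolding V by (simp only: image_insert)
    qed
    then show ?thesis using card_G by (simp add: bij_betw_def eq_card_imp_inj_on)
  qed
  have arcs_e: "map_prod e e ` parcs (D1 (Suc g)) = F"
  proof -
    have "{1..g} = insert g {1..g - 1}" using g by auto
    then have "{1..g} = insert g (Suc ` {..<g - 1})" by (simp add: image_Suc_lessThan)
    moreover have "(\<lambda>i. (e i, e (Suc i))) ` Suc ` {..<g - 1} = P"
      unfolding P_def image_image by (rule image_cong) (auto simp: e_def)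
    moreover have "e g = d (g - 1)" "e (Suc g) = w" by (simp_all add: e_def)
    ultimately have "(\<lambda>i. (e i, e (Suc i))) ` {1..g} = insert (d (g - 1), w) P"
      by (simp only: image_insert)
    then show ?thesis using g
      by (simp add: parcs_D1 image_Un image_image F_def) (auto simp: e_def)
  qed

  have shift2: "(\<lambda>i. i + 2) ` {..<h} = {2..<h + 2}" for h :: nat
    by (simp only: lessThan_atLeast0 image_add_atLeastLessThan') (simp add: numeral_2_eq_2)
  \<comment> \<open>In this numbering \<open>w\<close> is vertex 1. With \<open>n = Suc g\<close>,
    the arc \<open>(n - 1, 1)\<close> becomes \<open>(d (g - 2), w)\<close>, while the added arc
    \<open>(n, 2)\<close> closes the cycle as \<open>(d (g - 1), d 0)\<close>.\<close>
  define e' where "e' i = (if i = 1 then w else d (i - 2))" for i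
  have bij_e': "bij_betw e' {1..Suc g} (pverts G)"
  proof -
    have "e' ` {1..Suc g} = pverts G"
    proof -
      have "{1..Suc g} = insert 1 ((\<lambda>i. i + 2) ` {..<g})"
        unfolding shift2 by auto
      moreover have "e' ` (\<lambda>i. i + 2) ` {..<g} = d ` {..<g}"
        unfolding image_image by (rule image_cong) (auto simp: e'_def)
      moreover have "e' 1 = w" by (simp add: e'_def)
      ultimately show ?thesis unfolding V by (simp only: image_insert)
    qed
    then show ?thesis using card_G by (simp add: bij_betw_def eq_card_imp_inj_on)
  qed
  have arcs_e': "map_prod e' e' ` parcs (D2 (Suc g)) = insert (d (g - 2), w) F"
  proof -
    have "{1..g} = insert 1 ((\<lambda>i. i + 2) ` {..<g - 1})"
      unfolding shift2 using g by auto
    moreover have "(\<lambda>i. (e' i, e' (Suc i))) ` (\<lambda>i. i + 2) ` {..<g - 1} = P"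
      unfolding P_def image_image by (rule image_cong) (auto simp: e'_def)
    moreover have "e' 1 = w" "e' (Suc 1) = d 0" by (simp_all add: e'_def)
    ultimately have "(\<lambda>i. (e' i, e' (Suc i))) ` {1..g} = insert (w, d 0) P"
      by (simp only: image_insert)
    then show ?thesis using g
      by (simp add: parcs_D1 D2_def image_Un image_image F_def) (auto simp: e'_def)
  qed

  have pverts: "pverts (D1 (Suc g)) = {1..Suc g}" "pverts (D2 (Suc g)) = {1..Suc g}"
    by (simp_all add: D1_def D2_def)
  from cases show ?thesis
  proof (elim disjE)
    assume "parcs G = F"
    then have "digraph_iso (with_proj G) (with_proj (D1 (Suc g)))"
      using assms(1) bij_e arcs_e pverts D1_arcs_subset[of "Suc g"] g
      by (intro digraph_isoI_pair[of _ e]) auto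
    then show ?thesis ..
  next
    assume "parcs G = insert (w, d 1) F"
    then have "parcs G = map_prod e e ` parcs (D2 (Suc g))"
      using arcs_e g by (simp add: D2_def e_def)
    then have "digraph_iso (with_proj G) (with_proj (D2 (Suc g)))"
      using assms(1) bij_e pverts D2_arcs_subset[of "Suc g"] g
      by (intro digraph_isoI_pair[of _ e]) auto
    then show ?thesis ..
  next
    assume "parcs G = insert (d (g - 2), w) F"
    then have "digraph_iso (with_proj G) (with_proj (D2 (Suc g)))"
      using assms(1) bij_e' arcs_e' pverts D2_arcs_subset[of "Suc g"] g
      by (intro digraph_isoI_pair[of _ e']) auto
    then show ?thesis ..
  qed
qed

section \<open>Signed walks\<close>

context signed_digraph
begin

lemma underlying_wf_digraph: "pair_wf_digraph (underlying S)"
  using underlying_fin_digraph by (rule pair_fin_digraph.axioms)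

lemmas swalk_wf = wf_digraph_with_proj[OF underlying_wf_digraph]
lemmas swalk_Nil_iff = wf_digraph.awalk_Nil_iff[OF swalk_wf, simplified]
lemmas swalk_Cons_iff = wf_digraph.awalk_Cons_iff[OF swalk_wf, simplified]

lemma finite_sverts: "finite (sverts S)"
  using underlying_fin_digraph by (rule pair_fin_digraph.pair_finite_verts)

lemma parcs_in_sverts:
  assumes "(u, v) \<in> parcs (underlying S)"
  shows "u \<in> sverts S" "v \<in> sverts S"
  using assms underlying_wf_digraph by (auto simp: pair_wf_digraph_def)

text \<open>Only length, sign and ends of a walk matter: a pair of SSSD walks of length
  \<open>l\<close> exists iff this holds for both signs.\<close>

definition signed_walk :: "nat \<Rightarrow> int \<Rightarrow> 'a \<Rightarrow> 'a \<Rightarrow> bool" where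
  "signed_walk l s u v \<longleftrightarrow> (\<exists>p. swalk S u p v \<and> length p = l \<and> walk_sign S p = s)"

lemma signed_walk_append:
  assumes "signed_walk l s u v" and "signed_walk l' s' v w"
  shows "signed_walk (l + l') (s * s') u w"
proof -
  obtain p q where "swalk S u p v" "length p = l" "walk_sign S p = s"
    and "swalk S v q w" "length q = l'" "walk_sign S q = s'"
    using assms by (auto simp: signed_walk_def)
  then have "swalk S u (p @ q) w \<and> length (p @ q) = l + l' \<and> walk_sign S (p @ q) = s * s'"
    using wf_digraph.awalk_appendI[OF swalk_wf] by (auto simp: walk_sign_def)
  then show ?thesis unfolding signed_walk_def by blast
qed

lemma signed_walk_split:
  assumes "signed_walk (l + l') s u w"
  obtains v s1 s2 where "signed_walk l s1 u v" "signed_walk l' s2 v w" "s = s1 * s2"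
proof -
  obtain p where p: "swalk S u p w" "length p = l + l'" "walk_sign S p = s"
    using assms by (auto simp: signed_walk_def)
  let ?q = "take l p" and ?r = "drop l p"
  have "swalk S u (?q @ ?r) w" using p by simp
  then obtain v where "swalk S u ?q v" "swalk S v ?r w"
    unfolding wf_digraph.awalk_append_iff[OF swalk_wf] by blast
  then have "signed_walk l (walk_sign S ?q) u v" "signed_walk l' (walk_sign S ?r) v w"
    using p(2) by (auto simp: signed_walk_def)
  moreover have "s = walk_sign S ?q * walk_sign S ?r"
    using p(3) by (metis append_take_drop_id map_append prod_list.append walk_sign_def)
  ultimately show thesis by (rule that)
qed

lemma signed_walk_verts:
  assumes "signed_walk l s u v"
  shows "u \<in> sverts S" "v \<in> sverts S"
  using assms wf_digraph.awalk_hd_in_verts[OF swalk_wf] wf_digraph.awalk_last_in_verts[OF swalk_wf]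
  by (auto simp: signed_walk_def)

lemma signed_walk_sign:
  assumes "signed_walk l s u v"
  shows "s \<in> {1, -1}"
proof -
  have "prod_list (map (arc_sign S) p) \<in> {1, -1}" if "set p \<subseteq> parcs (underlying S)" for p
    using that by (induction p) (use arc_sign_values in \<open>fastforce+\<close>)
  then show ?thesis using assms by (auto simp: signed_walk_def walk_sign_def pre_digraph.awalk_def)
qed

text \<open>This transfers the results on relations to walks. The conjunct
  \<open>u \<in> sverts S\<close> matters for \<open>l = 0\<close>, where the power is the identity
  on the whole type.\<close>

lemma swalk_iff_relpow:
  "(\<exists>p. swalk S u p v \<and> length p = l) \<longleftrightarrow> u \<in> sverts S \<and> (u, v) \<in> parcs (underlying S) ^^ l"
proof (induction l arbitrary: u)
  case 0
  then show ?case by (auto simp: swalk_Nil_iff)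
next
  case (Suc l)
  have "(\<exists>p. swalk S u p v \<and> length p = Suc l) \<longleftrightarrow>
      (\<exists>x. (u, x) \<in> parcs (underlying S) \<and> (\<exists>p. swalk S x p v \<and> length p = l))"
  proof
    assume "\<exists>p. swalk S u p v \<and> length p = Suc l"
    then obtain e p where "swalk S u (e # p) v" "length p = l" by (metis length_Suc_conv)
    then show "\<exists>x. (u, x) \<in> parcs (underlying S) \<and> (\<exists>p. swalk S x p v \<and> length p = l)"
      by (cases e) (auto simp: swalk_Cons_iff)
  next
    assume "\<exists>x. (u, x) \<in> parcs (underlying S) \<and> (\<exists>p. swalk S x p v \<and> length p = l)"
    then obtain x p where "swalk S u ((u, x) # p) v" "length p = l"
      by (auto simp: swalk_Cons_iff)
    then show "\<exists>p. swalk S u p v \<and> length p = Suc l" by (metis length_Cons)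
  qed
  also have "\<dots> \<longleftrightarrow> u \<in> sverts S \<and> (u, v) \<in> parcs (underlying S) ^^ Suc l"
    unfolding Suc.IH by (meson parcs_in_sverts relpow_Suc_D2 relpow_Suc_I2)
  finally show ?case .
qed

lemma ex_signed_walk:
  assumes "u \<in> sverts S" and "(u, v) \<in> parcs (underlying S) ^^ l"
  obtains s where "signed_walk l s u v"
  using assms swalk_iff_relpow[of u v l] by (auto simp: signed_walk_def)

lemma sssd_walksI:
  assumes "signed_walk l 1 u v" and "signed_walk l (-1) u v"
  shows "\<exists>p q. sssd_walks S u v p q \<and> length p = l"
proof -
  obtain p q where "swalk S u p v" "length p = l" "walk_sign S p = 1"
    "swalk S u q v" "length q = l" "walk_sign S q = -1"
    using assms by (auto simp: signed_walk_def)
  then have "sssd_walks S u v p q \<and> length p = l" by (simp add: sssd_walks_def)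
  then show ?thesis by blast
qed

section \<open>Walks of both signs and the bound on the base\<close>

lemma primitive_relation_parcs:
  assumes "primitive_signed S" and "sverts S \<noteq> {}"
  obtains m where "primitive_relation (sverts S) (parcs (underlying S)) m"
proof -
  obtain m where "0 < m"
    and "\<forall>u\<in>sverts S. \<forall>v\<in>sverts S. \<exists>p. swalk S u p v \<and> length p = m"
    using assms(1) unfolding primitive_signed_def primitive_digraph_def by auto
  then have "primitive_relation (sverts S) (parcs (underlying S)) m"
    using assms(2) finite_sverts parcs_in_sverts unfolding swalk_iff_relpow
    by unfold_locales auto
  then show thesis by (rule that)
qed

text \<open>One SSSD pair is extended on both sides by walks that primitivity provides. The
  extensions multiply both signs by the same factor, so the signs stay different.\<close>

lemma eventually_both_signs:
  assumes "primitive_relation (sverts S) (parcs (underlying S)) m" and "non_powerful S"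
  obtains N where "\<And>l s u v. N \<le> l \<Longrightarrow> u \<in> sverts S \<Longrightarrow> v \<in> sverts S \<Longrightarrow> s \<in> {1, -1} \<Longrightarrow>
    signed_walk l s u v"
proof -
  interpret primitive_relation "sverts S" "parcs (underlying S)" m by fact
  obtain a b p q where "sssd_walks S a b p q" using assms(2) by (auto simp: non_powerful_def)
  then obtain k s1 s2 where pq: "signed_walk k s1 a b" "signed_walk k s2 a b" "s1 \<noteq> s2"
    by (auto simp: sssd_walks_def signed_walk_def)
  have ab: "a \<in> sverts S" "b \<in> sverts S" using signed_walk_verts[OF pq(1)] by auto
  have "signed_walk l s u v"
    if l: "m + k + m \<le> l" and uv: "u \<in> sverts S" "v \<in> sverts S" and s: "s \<in> {1, -1}" for l s u v
  proof -
    obtain t1 where t1: "signed_walk m t1 u a"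
      using ex_signed_walk[OF uv(1)] relpow_m[OF uv(1) ab(1)] by blast
    have m_le: "m \<le> l - (m + k)" using l by simp
    obtain t2 where t2: "signed_walk (l - (m + k)) t2 b v"
      using ex_signed_walk[OF ab(2)] relpow_ge[OF m_le ab(2) uv(2)] by blast
    have l_eq: "m + k + (l - (m + k)) = l" using l by simp
    have "signed_walk l (t1 * s1 * t2) u v" "signed_walk l (t1 * s2 * t2) u v"
      using signed_walk_append[OF signed_walk_append[OF t1 pq(1)] t2]
        signed_walk_append[OF signed_walk_append[OF t1 pq(2)] t2] l_eq by simp_all
    moreover have "s = t1 * s1 * t2 \<or> s = t1 * s2 * t2"
      using s signed_walk_sign[OF t1] signed_walk_sign[OF t2] signed_walk_sign[OF pq(1)]
        signed_walk_sign[OF pq(2)] pq(3) by auto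
    ultimately show ?thesis by blast
  qed
  then show thesis by (rule that)
qed

text \<open>
  Going once more around the closed walk at \<open>c\<close> embeds each of these sets, up to the sign of
  the closed walk, in the next one. If the sizes agree once, they agree forever, and then the
  set was already full.
\<close>

lemma card_signed_sources:
  assumes prim: "primitive_relation (sverts S) (parcs (underlying S)) m" and np: "non_powerful S"
    and loop: "signed_walk g \<epsilon> c c" and "0 < g"
  shows "min (Suc j) (2 * card (sverts S)) \<le> card {(u, s). signed_walk (g * j) s u c}"
proof -
  define B where "B j = {(u, s). signed_walk (g * j) s u c}" for j
  \<comment> \<open>This is the effect of one more turn around the closed walk at \<open>c\<close>.
    It is an involution because \<epsilon> is 1 or -1.\<close>
  define \<phi> where "\<phi> = (\<lambda>(u :: 'a, s :: int). (u, \<epsilon> * s))"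
  have \<epsilon>: "\<epsilon> * (\<epsilon> * s) = s" for s using signed_walk_sign[OF loop] by auto
  have inj: "inj_on \<phi> A" for A
    by (rule inj_on_inverseI[of _ \<phi>]) (auto simp: \<phi>_def \<epsilon>)
  have c: "c \<in> sverts S" using signed_walk_verts[OF loop] by simp
  have sub: "B j \<subseteq> sverts S \<times> {1, -1}" for j
    using signed_walk_verts(1) signed_walk_sign unfolding B_def by blast
  have fin: "finite (B j)" for j
    by (rule finite_subset[OF sub]) (use finite_sverts in simp)
  have step: "\<phi> ` B j \<subseteq> B (Suc j)" for j
  proof -
    have "signed_walk (g * j + g) (s * \<epsilon>) u c" if "signed_walk (g * j) s u c" for u s
      using signed_walk_append[OF that loop] .
    then show ?thesis by (auto simp: B_def \<phi>_def ac_simps)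
  qed
  \<comment> \<open>Split off the first \<open>g\<close> arcs of a walk: by assumption the rest can
    be replaced by a walk shorter by \<open>g\<close>, at the cost of a factor \<epsilon>.\<close>
  have stable: "B (Suc (Suc j)) = \<phi> ` B (Suc j)" if eq: "B (Suc j) = \<phi> ` B j" for j
  proof
    show "B (Suc (Suc j)) \<subseteq> \<phi> ` B (Suc j)"
    proof
      fix z assume "z \<in> B (Suc (Suc j))"
      then obtain u s where z: "z = (u, s)" and "signed_walk (g + g * Suc j) s u c"
        by (auto simp: B_def)
      then obtain x s1 s2 where 1: "signed_walk g s1 u x" and 2: "signed_walk (g * Suc j) s2 x c"
        and s: "s = s1 * s2" by (rule_tac signed_walk_split)
      have "(x, s2) \<in> \<phi> ` B j" using 2 eq by (auto simp: B_def)
      then obtain t where t: "signed_walk (g * j) t x c" "s2 = \<epsilon> * t"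
        by (auto simp: B_def \<phi>_def)
      have "(u, s1 * t) \<in> B (Suc j)"
        using signed_walk_append[OF 1 t(1)] by (simp add: B_def)
      moreover have "z = \<phi> (u, s1 * t)" using z s t(2) by (simp add: \<phi>_def)
      ultimately show "z \<in> \<phi> ` B (Suc j)" by blast
    qed
  qed (rule step)
  obtain N where N: "\<And>l s u v. N \<le> l \<Longrightarrow> u \<in> sverts S \<Longrightarrow> v \<in> sverts S \<Longrightarrow> s \<in> {1, -1} \<Longrightarrow>
    signed_walk l s u v"
    using eventually_both_signs[OF prim np] by blast
  have full: "card (B j) = 2 * card (sverts S)" if eq: "B (Suc j) = \<phi> ` B j" for j
  proof -
    have iter: "B (Suc (i + j)) = \<phi> ` B (i + j)" for i
      by (induction i) (use eq stable in simp_all)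
    have const: "card (B (i + j)) = card (B j)" for i
    proof (induction i)
      case (Suc i)
      then show ?case using iter[of i] card_image[OF inj, of "B (i + j)"] by simp
    qed simp
    \<comment> \<open>Far out in the chain every vertex occurs with both signs, which determines the
      constant size.\<close>
    have "N \<le> g * (N + j)" using \<open>0 < g\<close> by (cases g) auto
    then have "sverts S \<times> {1, -1} \<subseteq> B (N + j)" using N c by (auto simp: B_def)
    then have "B (N + j) = sverts S \<times> {1, -1}" using sub by blast
    then have "card (B (N + j)) = 2 * card (sverts S)" by (simp add: card_cartesian_product)
    then show ?thesis using const by simp
  qed
  have "min (Suc j) (2 * card (sverts S)) \<le> card (B j)" for j
  proof (induction j)
    case 0
    have "swalk S c [] c" using c by (simp add: swalk_Nil_iff)
    then have "signed_walk 0 1 c c" unfolding signed_walk_def walk_sign_def by force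
    then have "B 0 \<noteq> {}" by (auto simp: B_def)
    then show ?case using fin[of 0] by (simp add: card_gt_0_iff Suc_le_eq min.coboundedI1)
  next
    case (Suc j)
    show ?case
    proof (cases "B (Suc j) = \<phi> ` B j")
      case True
      then show ?thesis using full[OF True] card_image[OF inj, of "B j"] by simp
    next
      case False
      then have "card (\<phi> ` B j) < card (B (Suc j))"
        using step[of j] fin[of "Suc j"] by (metis psubsetI psubset_card_mono)
      then show ?thesis using Suc card_image[OF inj, of "B j"] by simp
    qed
  qed
  then show ?thesis by (simp add: B_def)
qed

lemma ex_both_signs_in:
  assumes prim: "primitive_relation (sverts S) (parcs (underlying S)) m" and np: "non_powerful S"
    and loop: "signed_walk g \<epsilon> c c" and "0 < g"
    and X: "X \<subseteq> sverts S" "card X = k" "1 \<le> k"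
  obtains x where "x \<in> X" "\<And>s. s \<in> {1, -1} \<Longrightarrow> signed_walk (g * (2 * card (sverts S) - k)) s x c"
proof -
  let ?n = "card (sverts S)"
  let ?l = "g * (2 * ?n - k)"
  define A where "A s = {u. signed_walk ?l s u c}" for s
  have k: "k \<le> ?n" using X card_mono[OF finite_sverts] by blast
  have A_sub: "A s \<subseteq> sverts S" for s using signed_walk_verts(1) by (auto simp: A_def)
  have A_fin: "finite (A s)" for s using finite_subset[OF A_sub finite_sverts] .
  have "{(u, s). signed_walk ?l s u c} = A 1 \<times> {1} \<union> A (-1) \<times> {-1}"
    using signed_walk_sign by (auto simp: A_def)
  then have "card {(u, s). signed_walk ?l s u c} = card (A 1) + card (A (-1))"
    using A_fin by (simp, subst card_Un_disjoint) (auto simp: card_cartesian_product)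
  \<comment> \<open>Since \<open>k\<close> is at least 1, \<open>Suc (2 * ?n - k)\<close> does not
    exceed \<open>2 * ?n\<close> and is the minimum in \<open>card_signed_sources\<close>.\<close>
  then have "2 * ?n - k < card (A 1) + card (A (-1))"
    using card_signed_sources[OF prim np loop \<open>0 < g\<close>, of "2 * ?n - k"] X(3) k by simp
  \<comment> \<open>Inclusion-exclusion is used twice: for the two sign classes, then for
    \<open>X\<close> and their intersection.\<close>
  moreover have "card (A 1) + card (A (-1)) = card (A 1 \<union> A (-1)) + card (A 1 \<inter> A (-1))"
    using card_Un_Int A_fin by blast
  moreover have "card (A 1 \<union> A (-1)) \<le> ?n"
    using A_sub finite_sverts by (intro card_mono) auto
  ultimately have "?n < card X + card (A 1 \<inter> A (-1))" using X(2) k by simp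
  moreover have "card X + card (A 1 \<inter> A (-1)) =
      card (X \<union> A 1 \<inter> A (-1)) + card (X \<inter> (A 1 \<inter> A (-1)))"
    using X(1) A_fin finite_subset[OF _ finite_sverts] by (intro card_Un_Int) auto
  moreover have "card (X \<union> A 1 \<inter> A (-1)) \<le> ?n"
    using A_sub X(1) finite_sverts by (intro card_mono) auto
  ultimately have "X \<inter> (A 1 \<inter> A (-1)) \<noteq> {}" by auto
  then show thesis using that by (auto simp: A_def)
qed

lemma set_exponent_le:
  assumes cyc: "shortest_cycle (sverts S) (parcs (underlying S)) m g c" and np: "non_powerful S"
    and X: "X \<subseteq> sverts S" "card X = k" "1 \<le> k"
  defines "n \<equiv> card (sverts S)"
  shows "set_exponent S X \<le> g * (2 * n - k) + (n - g)"
  unfolding set_exponent_def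
proof (rule Least_le, intro ballI)
  fix v assume v: "v \<in> sverts S"
  interpret shortest_cycle "sverts S" "parcs (underlying S)" m g c by fact
  obtain i where i: "(c i, v) \<in> parcs (underlying S) ^^ (n - g)"
    using walk_from_cycle[OF v] n_def by blast
  obtain t where t: "signed_walk (n - g) t (c i) v"
    using ex_signed_walk[OF cycle_in_verts i] by blast
  \<comment> \<open>The point \<open>c i\<close> depends on \<open>v\<close>, so the closed walk
    around the cycle is based at \<open>c i\<close>.\<close>
  have "(c i, c i) \<in> parcs (underlying S) ^^ g"
    using cycle_relpow[of i "i + g"] cycle_period by simp
  then obtain \<epsilon> where "signed_walk g \<epsilon> (c i) (c i)"
    using ex_signed_walk[OF cycle_in_verts] by blast
  then obtain x where x: "x \<in> X" "\<And>s. s \<in> {1, -1} \<Longrightarrow> signed_walk (g * (2 * n - k)) s x (c i)"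
    using ex_both_signs_in[OF primitive_relation_axioms np _ g_pos X] n_def by blast
  let ?r = "g * (2 * n - k) + (n - g)"
  \<comment> \<open>Appending a walk of sign \<open>t\<close> at most exchanges the two
    signs.\<close>
  have "signed_walk ?r (1 * t) x v" "signed_walk ?r (-1 * t) x v"
    using x(2) signed_walk_append[OF _ t] by blast+
  then have "signed_walk ?r 1 x v" "signed_walk ?r (-1) x v"
    using signed_walk_sign[OF t] by auto
  then show "\<exists>x\<in>X. \<exists>p q. sssd_walks S x v p q \<and> length p = ?r"
    using sssd_walksI x(1) by blast
qed

lemma upper_base_le:
  assumes cyc: "shortest_cycle (sverts S) (parcs (underlying S)) m g c" and np: "non_powerful S"
    and "1 \<le> k" and "k \<le> card (sverts S)"
  shows "upper_base S k \<le> g * (2 * card (sverts S) - k) + (card (sverts S) - g)"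
proof -
  let ?A = "{set_exponent S X | X. X \<subseteq> sverts S \<and> card X = k}"
  have "?A \<subseteq> set_exponent S ` Pow (sverts S)" by blast
  then have fin: "finite ?A" by (rule finite_subset) (simp add: finite_sverts)
  \<comment> \<open>A \<open>k\<close>-subset is exhibited because \<open>Max\<close> of the empty
    set is unspecified.\<close>
  obtain X where "X \<subseteq> sverts S" "card X = k" using obtain_subset_with_card_n[OF assms(4)] by metis
  then have "?A \<noteq> {}" by blast
  then show ?thesis
    unfolding upper_base_def
  proof (rule Max.boundedI[OF fin])
    fix r assume "r \<in> ?A"
    then obtain X where "r = set_exponent S X" "X \<subseteq> sverts S" "card X = k" by auto
    then show "r \<le> g * (2 * card (sverts S) - k) + (card (sverts S) - g)"
      using set_exponent_le[OF cyc np] assms(3) by simp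
  qed
qed

end

section \<open>Comparison with the claimed bound\<close>

theorem theorem3p6:
  fixes S :: "'a signed_digraph" and n k :: nat
  assumes "signed_digraph S"
    and "primitive_signed S"
    and "non_powerful S"
    and "card (sverts S) = n"
    and "n \<ge> 6"
    and "\<not> digraph_iso (with_proj (underlying S)) (with_proj (D1 n))"
    and "\<not> digraph_iso (with_proj (underlying S)) (with_proj (D2 n))"
    and "1 \<le> k" and "k \<le> n"
  shows "int (upper_base S k) \<le> (2 * int n - int k) * (int n - 1) - 3"
proof -
  interpret signed_digraph S by fact
  have "sverts S \<noteq> {}" using assms(4,5) by auto
  then obtain m where "primitive_relation (sverts S) (parcs (underlying S)) m"
    using primitive_relation_parcs assms(2) by blast
  then obtain g c where cyc: "shortest_cycle (sverts S) (parcs (underlying S)) m g c"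
    using primitive_relation.ex_shortest_cycle by blast
  have "g < n" using shortest_cycle.girth_less_card[OF cyc] assms(4,5) by simp
  moreover have "n \<noteq> Suc g"
  proof
    assume n: "n = Suc g"
    then have "card (sverts S) = Suc g" "4 \<le> g" using assms(4,5) by simp_all
    from digraph_iso_D1_D2[OF underlying_wf_digraph cyc this]
    show False using assms(6,7) unfolding n by blast
  qed
  ultimately have g: "int g \<le> int n - 2" by simp
  have "int (upper_base S k) \<le> int (g * (2 * n - k) + (n - g))"
    using upper_base_le[OF cyc assms(3,8)] assms(4,9) by (intro of_nat_mono) simp
  also have "\<dots> = int g * (2 * int n - int k - 1) + int n"
  proof -
    have "int (2 * n - k) = 2 * int n - int k" "int (n - g) = int n - int g"
      using assms(9) \<open>g < n\<close> by (simp_all add: of_nat_diff)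
    then show ?thesis by (simp only: of_nat_add of_nat_mult) (simp add: algebra_simps)
  qed
  \<comment> \<open>The cofactor \<open>2 * int n - int k - 1\<close> is nonnegative, so
    \<open>g\<close> may be replaced by its upper bound.\<close>
  also have "\<dots> \<le> (int n - 2) * (2 * int n - int k - 1) + int n"
    using g assms(5,9) by (intro add_right_mono mult_right_mono) auto
  \<comment> \<open>The right side exceeds the left by \<open>2 * int n - int k - 5\<close>, which
    is positive because \<open>k \<le> n\<close> and \<open>n \<ge> 6\<close>.\<close>
  also have "\<dots> \<le> (2 * int n - int k) * (int n - 1) - 3"
    using assms(5,9) by (simp add: algebra_simps)
  finally show ?thesis .
qed

end
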